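(* Let $q$ and $q+2$ both be prime powers, and let $N_\beta$ ($\beta\in\mathbb{F}_{q+2}^*$) be the matrices defined in the context. Define $A_0=I_{(q+2)q^2}$, $A_1=(J_{q+2}-I_{q+2})\otimes I_{q^2}$, $A_2=I_{q+2}\otimes(J_{q^2}-I_{q^2})$, and $A_{3,\beta}=N_\beta-A_1$ for $\beta\in\mathbb{F}_{q+2}^*$. Then $A_0,A_1,A_2,A_{3,\beta}$ ($\beta\in\mathbb{F}_{q+2}^*$) form a commutative association scheme with $q+3$ classes.
   Context: $I_n,J_n$ are the identity and all-ones matrices of order $n$, $\mathbb{F}_r^*=\mathbb{F}_r\setminus\{0\}$, $\otimes$ is the Kronecker product. Let $x,y$ be two new symbols and fix a bijection $\varphi:\mathbb{F}_{q+2}\to\mathbb{F}_q\cup\{x,y\}$ with $\varphi(0)=x$. Matrices of order $(q+2)q^2$ have rows and columns indexed by $\mathbb{F}_{q+2}\times\mathbb{F}_q\times\mathbb{F}_q$ (lexicographic order, compatible with the Kronecker products). For $\beta\in\mathbb{F}_{q+2}^*$, $N_\beta$ is the $(0,1)$-matrix whose $((b,a_1,a_2),(b',a_1',a_2'))$-entry is: with $c=\varphi(\beta(b'-b))$, the entry is $1$ if $c\in\mathbb{F}_q$ and $a_2'-a_2=c(a_1'-a_1)$, or if $c=y$ and $a_1=a_1'$; and $0$ otherwise. A family of nonzero $(0,1)$-matrices $A_0,A_1,\dots,A_n$ indexed by a finite set $X$ forms a commutative association scheme with $n$ classes if: $A_0=I_{|X|}$; $\sum_{i=0}^nA_i=J_{|X|}$;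 for each $i\geq1$, $A_i^\top\in\{A_1,\dots,A_n\}$; each product $A_iA_j$ is a linear combination of $A_0,\dots,A_n$; and $A_iA_j=A_jA_i$ for all $i,j$. *)

theory Defs
  imports "HOL-Analysis.Analysis" "HOL-Number_Theory.Prime_Powers"
begin

(* Matrices are indexed by finite types, M $ i $ j being the entry in row i and column j.
   Finite fields are types of class {field, finite}. *)

definition all_ones :: "real ^ 'n ^ 'm"
  where "all_ones = (\<chi> i j. 1)"

definition kronecker ::
  "real ^ 'n ^ 'm \<Rightarrow> real ^ 'l ^ 'k \<Rightarrow> real ^ ('n \<times> 'l) ^ ('m \<times> 'k)" (infixl "\<otimes>\<^sub>K" 70)
  where "M \<otimes>\<^sub>K M' = (\<chi> i j. M $ fst i $ fst j * M' $ snd i $ snd j)"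

(* A family indexed by a finite set I of n + 1 elements, whose distinguished element z
   plays the role of the index 0. *)
definition commutative_association_scheme ::
  "nat \<Rightarrow> 'i set \<Rightarrow> 'i \<Rightarrow> ('i \<Rightarrow> real ^ 'x ^ 'x) \<Rightarrow> bool"
  where "commutative_association_scheme n I z A \<longleftrightarrow>
    finite I \<and> card I = n + 1 \<and> z \<in> I \<and>
    (\<forall>i\<in>I. A i \<noteq> 0 \<and> (\<forall>s t. A i $ s $ t \<in> {0, 1})) \<and>
    A z = mat 1 \<and>
    (\<Sum>i\<in>I. A i) = all_ones \<and>
    (\<forall>i\<in>I - {z}. transpose (A i) \<in> A ` (I - {z})) \<and>
    (\<forall>i\<in>I. \<forall>j\<in>I. \<exists>p. A i ** A j = (\<Sum>k\<in>I. p k *\<^sub>R A k)) \<and>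
    (\<forall>i\<in>I. \<forall>j\<in>I. A i ** A j = A j ** A i)"

(* The field 'q extended by two new symbols x and y. *)
datatype 'q extended_field = Elem 'q | Sym_x | Sym_y

definition N_matrix ::
  "('r::{field,finite} \<Rightarrow> 'q::{field,finite} extended_field) \<Rightarrow> 'r
    \<Rightarrow> real ^ ('r \<times> 'q \<times> 'q) ^ ('r \<times> 'q \<times> 'q)"
  where "N_matrix \<phi> \<beta> =
    vec_lambda (\<lambda>(b, a1, a2). vec_lambda (\<lambda>(b', a1', a2').
      case \<phi> (\<beta> * (b' - b)) of
        Elem c \<Rightarrow> if a2' - a2 = c * (a1' - a1) then 1 else 0
      | Sym_y \<Rightarrow> if a1 = a1' then 1 else 0
      | Sym_x \<Rightarrow> 0))"

datatype 'r scheme_index = Ix0 | Ix1 | Ix2 | Ix3 'r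

definition scheme_indices :: "'r::zero scheme_index set"
  where "scheme_indices = {Ix0, Ix1, Ix2} \<union> Ix3 ` {\<beta>. \<beta> \<noteq> 0}"

definition A1_matrix ::
  "real ^ ('r::{field,finite} \<times> 'q::{field,finite} \<times> 'q) ^ ('r \<times> 'q \<times> 'q)"
  where "A1_matrix = (all_ones - mat 1) \<otimes>\<^sub>K mat 1"

fun scheme_matrix ::
  "('r::{field,finite} \<Rightarrow> 'q::{field,finite} extended_field) \<Rightarrow> 'r scheme_index
    \<Rightarrow> real ^ ('r \<times> 'q \<times> 'q) ^ ('r \<times> 'q \<times> 'q)"
  where
    "scheme_matrix \<phi> Ix0 = mat 1"
  | "scheme_matrix \<phi> Ix1 = A1_matrix"
  | "scheme_matrix \<phi> Ix2 = mat 1 \<otimes>\<^sub>K (all_ones - mat 1)"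
  | "scheme_matrix \<phi> (Ix3 \<beta>) = N_matrix \<phi> \<beta> - A1_matrix"

end

theory Submission imports Defs begin

text \<open>
  Write \<open>P c\<close> for the adjacency matrix of the parallel class of slope \<open>c\<close> in the affine plane,
  and \<open>P x = 0\<close>.  Then \<open>P c ** P d\<close> is \<open>q P c\<close> if \<open>c = d\<close> and \<open>J\<close> if \<open>c \<noteq> d\<close> are both different
  from \<open>x\<close>, and the sum of all \<open>P c\<close> is \<open>J + q I\<close>.  The block \<open>(b, b')\<close> of \<open>N \<beta>\<close> is
  \<open>P (\<phi> (\<beta> (b' - b)))\<close>.  In the block \<open>(b, b'')\<close> of \<open>N \<beta> ** N \<gamma>\<close> the summand for \<open>b'\<close> differs
  from \<open>J\<close> only if \<open>\<beta> (b' - b) = \<gamma> (b'' - b')\<close>.  For \<open>\<beta> + \<gamma> \<noteq> 0\<close> this has exactly one solution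
  \<open>b'\<close>, whose contribution comes from \<open>N (\<beta> \<gamma> / (\<beta> + \<gamma>))\<close>; for \<open>\<beta> + \<gamma> = 0\<close> it holds only on the
  diagonal blocks, and there for every \<open>b'\<close>.  The resulting formula is symmetric in \<open>\<beta>\<close> and \<open>\<gamma>\<close>.
  Replacing the matrices of the scheme by the spanning family \<open>I\<close>, \<open>J \<otimes> I\<close>, \<open>I \<otimes> J\<close>, \<open>N \<beta>\<close>
  makes the remaining products immediate.
\<close>

section \<open>Spans of commuting families\<close>

lemma bilinear_matrix_matrix_mult:
  "bilinear ((**) :: real ^ 'n ^ 'm \<Rightarrow> real ^ 'k ^ 'n \<Rightarrow> real ^ 'k ^ 'm)"
  unfolding bilinear_def
  by (intro conjI allI linearI)
    (simp_all add: vec_eq_iff matrix_matrix_mult_def sum.distrib algebra_simps sum_distrib_left)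

text \<open>Bilinearity reduces closure to generators: first the right factor runs through the span
  with a generator on the left, then the left factor does.\<close>

lemma span_matrix_mult_closed:
  fixes B :: "(real ^ 'n ^ 'n) set"
  assumes "\<And>M N. M \<in> B \<Longrightarrow> N \<in> B \<Longrightarrow> M ** N \<in> span B"
    and M: "M \<in> span B" and N: "N \<in> span B"
  shows "M ** N \<in> span B"
proof -
  have l: "linear (\<lambda>M. M ** N)" and r: "linear (\<lambda>N. M ** N)" for M N :: "real ^ 'n ^ 'n"
    using bilinear_matrix_matrix_mult unfolding bilinear_def by blast+
  have "(\<lambda>N. M ** N) ` span B \<subseteq> span B" if "M \<in> B" for M
    unfolding linear_span_image[OF r, symmetric] using assms(1) that
    by (intro span_minimal) auto
  then have "(\<lambda>M. M ** N) ` span B \<subseteq> span B"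
    unfolding linear_span_image[OF l, symmetric] using N
    by (intro span_minimal) auto
  with M show ?thesis by auto
qed

lemma span_matrix_mult_commute:
  fixes B :: "(real ^ 'n ^ 'n) set"
  assumes "\<And>M N. M \<in> B \<Longrightarrow> N \<in> B \<Longrightarrow> M ** N = N ** M"
    and M: "M \<in> span B" and N: "N \<in> span B"
  shows "M ** N = N ** M"
proof -
  have l: "linear (\<lambda>M. M ** N)" and r: "linear (\<lambda>N. M ** N)" for M N :: "real ^ 'n ^ 'n"
    using bilinear_matrix_matrix_mult unfolding bilinear_def by blast+
  have "M ** N = N ** M" if "M \<in> B" for M
    using linear_eq_on_span[OF r[of M] l[of M] _ N] assms(1) that by auto
  then show ?thesis
    using linear_eq_on_span[OF l[of N] r[of N] _ M] by auto
qed

text \<open>Coefficients are indexed by \<open>I\<close> rather than by the image of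
  \<open>f\<close>, as the scheme axiom requires; so \<open>f\<close> may repeat values.\<close>

lemma span_image_imp_sum:
  assumes "finite I" and "v \<in> span (f ` I)"
  shows "\<exists>p. v = (\<Sum>i\<in>I. p i *\<^sub>R f i)"
proof -
  let ?S = "range (\<lambda>p. \<Sum>i\<in>I. p i *\<^sub>R f i)"
  have "subspace ?S"
  proof (rule subspaceI)
    show "0 \<in> ?S"
      by (rule range_eqI[where x = "\<lambda>_. 0"]) simp
  next
    fix x y assume "x \<in> ?S" "y \<in> ?S"
    then obtain p r where "x = (\<Sum>i\<in>I. p i *\<^sub>R f i)" "y = (\<Sum>i\<in>I. r i *\<^sub>R f i)"
      by auto
    then show "x + y \<in> ?S"
      by (intro range_eqI[where x = "\<lambda>i. p i + r i"]) (simp add: scaleR_add_left sum.distrib)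
  next
    fix c x assume "x \<in> ?S"
    then obtain p where "x = (\<Sum>i\<in>I. p i *\<^sub>R f i)"
      by auto
    then show "c *\<^sub>R x \<in> ?S"
      by (intro range_eqI[where x = "\<lambda>i. c * p i"]) (simp add: scaleR_sum_right)
  qed
  moreover have "f ` I \<subseteq> ?S"
  proof
    fix x assume "x \<in> f ` I"
    then obtain j where "j \<in> I" "x = f j"
      by auto
    then have "x = (\<Sum>i\<in>I. of_bool (i = j) *\<^sub>R f i)"
      using \<open>finite I\<close> by (simp add: of_bool_def if_distrib[of "\<lambda>c. c *\<^sub>R _"] sum.delta cong: if_cong)
    then show "x \<in> ?S"
      by (rule range_eqI[where x = "\<lambda>i. of_bool (i = j)"])
  qed
  ultimately show ?thesis
    using span_minimal assms(2) by blast
qed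

section \<open>Parallel classes of lines in the affine plane\<close>

text \<open>The level sets are the lines of one parallel class, with \<open>Sym_y\<close> for the
  vertical ones. The value at \<open>Sym_x\<close> is a dummy that \<open>line_matrix\<close>
  masks.\<close>

fun line_coord :: "'q::field extended_field \<Rightarrow> 'q \<times> 'q \<Rightarrow> 'q" where
  "line_coord (Elem c) p = snd p - c * fst p"
| "line_coord Sym_y p = fst p"
| "line_coord Sym_x p = 0"

definition line_matrix ::
  "'q::{field,finite} extended_field \<Rightarrow> real ^ ('q \<times> 'q) ^ ('q \<times> 'q)"
  where "line_matrix c = (\<chi> i j. of_bool (c \<noteq> Sym_x \<and> line_coord c i = line_coord c j))"

lemma line_matrix_Sym_x [simp]: "line_matrix Sym_x = 0"
  by (simp add: line_matrix_def vec_eq_iff)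

lemma transpose_line_matrix: "transpose (line_matrix c) = line_matrix c"
  by (auto simp: line_matrix_def transpose_def vec_eq_iff)

lemma card_line:
  fixes c :: "'q::{field,finite} extended_field"
  assumes "c \<noteq> Sym_x"
  shows "card {k. line_coord c k = s} = CARD('q)"
proof (cases c)
  case (Elem d)
  have "bij_betw (\<lambda>a. (a, s + d * a)) UNIV {k. line_coord c k = s}"
    using Elem by (intro bij_betwI[where g = fst]) (auto simp: algebra_simps)
  then show ?thesis
    by (simp add: bij_betw_same_card)
next
  case Sym_y
  have "bij_betw (\<lambda>a. (s, a)) UNIV {k. line_coord c k = s}"
    using Sym_y by (intro bij_betwI[where g = snd]) auto
  then show ?thesis
    by (simp add: bij_betw_same_card)
qed (use assms in auto)

text \<open>Non-parallel lines meet once: the pair of line coordinates is an injective map between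
  finite sets of equal size, hence a bijection.\<close>

lemma card_line_Int_line:
  fixes c d :: "'q::{field,finite} extended_field"
  assumes "c \<noteq> Sym_x" "d \<noteq> Sym_x" "c \<noteq> d"
  shows "card {k. line_coord c k = s \<and> line_coord d k = t} = 1"
proof -
  let ?f = "\<lambda>k. (line_coord c k, line_coord d k)"
  have "inj ?f"
  proof (rule injI)
    fix k l assume eq: "?f k = ?f l"
    have lines: "fst k = fst l \<and> snd k = snd l"
      if "a \<noteq> b" "snd k - a * fst k = snd l - a * fst l" "snd k - b * fst k = snd l - b * fst l"
      for a b
    proof -
      have "(a - b) * (fst k - fst l) = 0"
        using that(2,3) by algebra
      then have "fst k = fst l"
        using that(1) by simp
      with that(2) show ?thesis by simp
    qed
    show "k = l"
    proof (cases c)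
      case c: (Elem a)
      show ?thesis
      proof (cases d)
        case (Elem b)
        with c eq assms(3) show ?thesis
          using lines[of a b] by (simp add: prod_eq_iff)
      qed (use c eq assms in \<open>auto simp: prod_eq_iff\<close>)
    next
      case Sym_y
      with eq assms show ?thesis
        by (cases d) (auto simp: prod_eq_iff)
    qed (use assms in auto)
  qed
  then have "bij ?f"
    by (simp add: bij_def finite_UNIV_inj_surj)
  then have "(s, t) \<in> range ?f"
    by (simp only: bij_is_surj UNIV_I)
  then obtain k where k: "(s, t) = ?f k"
    by (rule rangeE)
  have "l = k" if "line_coord c l = s" "line_coord d l = t" for l
  proof -
    have "?f l = ?f k"
      using k that by simp
    with \<open>inj ?f\<close> show ?thesis
      by (rule injD)
  qed
  with k have "{k. line_coord c k = s \<and> line_coord d k = t} = {k}"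
    by blast
  then show ?thesis by simp
qed

text \<open>Entry \<open>(i, j)\<close> counts the points common to the \<open>c\<close>-line
  through \<open>i\<close> and the \<open>d\<close>-line through \<open>j\<close>. Lines of the same
  class coincide or are disjoint.\<close>

lemma line_matrix_mult:
  fixes c d :: "'q::{field,finite} extended_field"
  assumes "c \<noteq> Sym_x" "d \<noteq> Sym_x"
  shows "line_matrix c ** line_matrix d =
    (if c = d then real CARD('q) *\<^sub>R line_matrix c else all_ones)"
proof -
  have "(line_matrix c ** line_matrix d) $ i $ j =
      (\<Sum>k\<in>UNIV. of_bool (line_coord c k = line_coord c i \<and> line_coord d k = line_coord d j))" for i j
    unfolding matrix_matrix_mult_def line_matrix_def vec_lambda_beta of_bool_conj[symmetric]
    using assms by (intro sum.cong arg_cong[where f = of_bool]) auto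
  then have "(line_matrix c ** line_matrix d) $ i $ j =
      card {k. line_coord c k = line_coord c i \<and> line_coord d k = line_coord d j}" for i j
    by simp
  moreover have "{k. line_coord c k = line_coord c i \<and> line_coord c k = line_coord c j} =
      (if line_coord c i = line_coord c j then {k. line_coord c k = line_coord c i} else {})" for i j
    by auto
  ultimately show ?thesis
    using assms by (auto simp: vec_eq_iff line_matrix_def all_ones_def card_line card_line_Int_line)
qed

lemma line_matrix_mult_all_ones:
  fixes c :: "'q::{field,finite} extended_field"
  assumes "c \<noteq> Sym_x"
  shows "line_matrix c ** all_ones = (real CARD('q) *\<^sub>R all_ones :: real ^ _ ^ _)"
    and "all_ones ** line_matrix c = (real CARD('q) *\<^sub>R all_ones :: real ^ _ ^ _)"
proof -
  have "{k. line_coord c i = line_coord c k} = {k. line_coord c k = line_coord c i}" for i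
    by auto
  then show "line_matrix c ** all_ones = (real CARD('q) *\<^sub>R all_ones :: real ^ _ ^ _)"
    and "all_ones ** line_matrix c = (real CARD('q) *\<^sub>R all_ones :: real ^ _ ^ _)"
    using assms
    by (auto simp: vec_eq_iff matrix_matrix_mult_def line_matrix_def all_ones_def card_line)
qed

lemma UNIV_extended_field:
  "(UNIV :: 'q extended_field set) = insert Sym_x (insert Sym_y (range Elem))"
proof -
  have "c \<in> insert Sym_x (insert Sym_y (range Elem))" for c :: "'q extended_field"
    by (cases c) auto
  then show ?thesis by auto
qed

text \<open>Two distinct points lie on exactly one common line, whereas a point lies on one line of
  each of the \<open>q + 1\<close> classes.\<close>

lemma sum_line_matrix:
  "(\<Sum>c\<in>UNIV. line_matrix c) =
    (all_ones + real CARD('q) *\<^sub>R mat 1 :: real ^ ('q::{field,finite} \<times> 'q) ^ ('q \<times> 'q))"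
proof -
  have "(\<Sum>c\<in>UNIV. line_matrix c) = line_matrix Sym_y + (\<Sum>c\<in>UNIV. line_matrix (Elem c :: 'q extended_field))"
    unfolding UNIV_extended_field
    by (subst sum.insert; (subst sum.insert)?) (auto simp: sum.reindex inj_def)
  \<comment> \<open>The subtracted term is the contribution of the vertical class
    \<open>Sym_y\<close>, split off before.\<close>
  moreover have "(\<Sum>c\<in>UNIV. of_bool (snd i - c * fst i = snd j - c * fst j)) =
      (1 + real CARD('q) * of_bool (i = j) - of_bool (fst i = fst j))" for i j :: "'q \<times> 'q"
  proof (cases "fst i = fst j")
    case True
    then show ?thesis
      by (auto simp: prod_eq_iff)
  next
    case False
    have "snd i - c * fst i = snd j - c * fst j \<longleftrightarrow> c * (fst i - fst j) = snd i - snd j" for c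
      by (simp add: algebra_simps) (metis add.commute)
    then have "snd i - c * fst i = snd j - c * fst j \<longleftrightarrow> c = (snd i - snd j) / (fst i - fst j)" for c
      using False by (simp add: eq_divide_eq)
    with False show ?thesis
      by auto
  qed
  ultimately show ?thesis
    by (auto simp: vec_eq_iff line_matrix_def all_ones_def mat_def)
qed

section \<open>Block matrices\<close>

text \<open>Since products nest to the right, \<open>'r \<times> 'q \<times> 'q\<close> fits this
  shape with \<open>'r\<close> indexing the blocks and the plane \<open>'q \<times> 'q\<close>
  indexing the entries within a block.\<close>

definition block_matrix :: "('b::finite \<Rightarrow> 'b \<Rightarrow> real ^ 'p ^ 'p) \<Rightarrow> real ^ ('b \<times> 'p) ^ ('b \<times> 'p)"
  where "block_matrix F = (\<chi> s t. F (fst s) (fst t) $ snd s $ snd t)"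

lemma block_matrix_mult:
  "block_matrix F ** block_matrix G = block_matrix (\<lambda>b b''. \<Sum>b'\<in>UNIV. F b b' ** G b' b'')"
proof -
  have "(\<Sum>k\<in>UNIV. F b (fst k) $ i $ snd k * G (fst k) b'' $ snd k $ j) =
      (\<Sum>b'\<in>UNIV. \<Sum>k\<in>UNIV. F b b' $ i $ k * G b' b'' $ k $ j)" for b b'' i j
    unfolding sum.cartesian_product UNIV_Times_UNIV split_def ..
  then show ?thesis
    by (simp add: block_matrix_def matrix_matrix_mult_def vec_eq_iff)
qed

lemma block_matrix_add: "block_matrix F + block_matrix G = block_matrix (\<lambda>b b'. F b b' + G b b')"
  and block_matrix_diff: "block_matrix F - block_matrix G = block_matrix (\<lambda>b b'. F b b' - G b b')"
  and block_matrix_scaleR: "r *\<^sub>R block_matrix F = block_matrix (\<lambda>b b'. r *\<^sub>R F b b')"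
  and block_matrix_sum: "(\<Sum>i\<in>I. block_matrix (H i)) = block_matrix (\<lambda>b b'. \<Sum>i\<in>I. H i b b')"
  and transpose_block_matrix: "transpose (block_matrix F) = block_matrix (\<lambda>b b'. transpose (F b' b))"
  by (simp_all add: block_matrix_def vec_eq_iff transpose_def)

lemma mat_1_eq_block: "mat 1 = block_matrix (\<lambda>b b'. if b = b' then mat 1 else 0)"
  by (auto simp: block_matrix_def vec_eq_iff mat_def)

lemma all_ones_eq_block: "all_ones = block_matrix (\<lambda>b b'. all_ones)"
  by (simp add: block_matrix_def vec_eq_iff all_ones_def)

lemma all_ones_kronecker_eq_block: "all_ones \<otimes>\<^sub>K M = block_matrix (\<lambda>b b'. M)"
  by (simp add: block_matrix_def vec_eq_iff kronecker_def all_ones_def)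

lemma mat_1_kronecker_eq_block: "mat 1 \<otimes>\<^sub>K M = block_matrix (\<lambda>b b'. if b = b' then M else 0)"
  by (auto simp: block_matrix_def vec_eq_iff mat_def kronecker_def)

lemma N_matrix_eq_block:
  "N_matrix \<phi> \<beta> = block_matrix (\<lambda>b b'. line_matrix (\<phi> (\<beta> * (b' - b))))"
proof -
  \<comment> \<open>Lying on a line of slope \<open>c\<close> becomes equality of intercepts, the
    form used by \<open>line_coord\<close>.\<close>
  have "v - u = c * (y - x) \<longleftrightarrow> u - c * x = v - c * y" for c x y u v :: 'b
    by algebra
  then show ?thesis
    by (simp add: block_matrix_def vec_eq_iff line_matrix_def N_matrix_def
        split: extended_field.split)
qed

lemma matrix_mult_zero [simp]: "M ** (0 :: real ^ 'k ^ 'n) = 0" "(0 :: real ^ 'n ^ 'm) ** N = 0"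
  by (simp_all add: matrix_matrix_mult_def vec_eq_iff)

lemma all_ones_mult_all_ones:
  "(all_ones :: real ^ 'n ^ 'm) ** (all_ones :: real ^ 'k ^ 'n) = real CARD('n) *\<^sub>R all_ones"
  by (simp add: matrix_matrix_mult_def vec_eq_iff all_ones_def)

lemma sum_block_delta:
  fixes f :: "'b::finite \<Rightarrow> real ^ 'n ^ 'n"
  shows "(\<Sum>b'\<in>UNIV. (if b = b' then M else 0) ** f b') = M ** f b"
    and "(\<Sum>b'\<in>UNIV. f b' ** (if b' = b then M else 0)) = f b ** M"
  by (simp_all add: if_distrib[of "\<lambda>X. X ** _"] if_distrib[of "\<lambda>X. _ ** X"] cong: if_cong)

text \<open>Hence along a block row or block column of \<open>N_matrix\<close> every parallel class,
  and the zero block, occurs exactly once.\<close>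

lemma bij_scaled_difference:
  fixes \<beta> b :: "'a::field"
  assumes "\<beta> \<noteq> 0"
  shows "bij (\<lambda>b'. \<beta> * (b' - b))" and "bij (\<lambda>b'. \<beta> * (b - b'))"
proof -
  show "bij (\<lambda>b'. \<beta> * (b' - b))"
    using assms by (intro bijI' exI[of _ "_ / \<beta> + b"]) auto
  show "bij (\<lambda>b'. \<beta> * (b - b'))"
    using assms by (intro bijI' exI[of _ "b - _ / \<beta>"]) auto
qed

lemma bij_mult_right: "b \<noteq> 0 \<Longrightarrow> bij (\<lambda>\<gamma>. \<gamma> * b)" for b :: "'a::field"
  by (intro bijI' exI[of _ "_ / b"]) auto

section \<open>Products of the generating matrices\<close>

context
  fixes \<phi> :: "'r::{field,finite} \<Rightarrow> 'q::{field,finite} extended_field"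
  assumes bij: "bij \<phi>" and \<phi>_0: "\<phi> 0 = Sym_x"
begin

lemma \<phi>_eq_Sym_x_iff: "\<phi> v = Sym_x \<longleftrightarrow> v = 0"
  using bij \<phi>_0 by (metis bij_is_inj injD)

lemma sum_line_matrix_bij:
  assumes "bij f"
  shows "(\<Sum>b\<in>UNIV. line_matrix (\<phi> (f b))) = all_ones + real CARD('q) *\<^sub>R mat 1"
  using sum.reindex_bij_betw[OF bij_comp[OF assms bij], of line_matrix]
  by (simp add: sum_line_matrix)

text \<open>The fixed outer index type keeps rewriting from splitting the inner matrices, whose
  index type \<open>'q \<times> 'q\<close> is a product as well.\<close>

lemma outer_eq_block:
  "(mat 1 :: real ^ ('r \<times> 'q \<times> 'q) ^ ('r \<times> 'q \<times> 'q)) =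
    block_matrix (\<lambda>b b'. if b = b' then mat 1 else 0)"
  "(all_ones :: real ^ ('r \<times> 'q \<times> 'q) ^ ('r \<times> 'q \<times> 'q)) = block_matrix (\<lambda>b b'. all_ones)"
  by (fact mat_1_eq_block all_ones_eq_block)+

lemmas to_block_matrix =
  outer_eq_block all_ones_kronecker_eq_block mat_1_kronecker_eq_block
  N_matrix_eq_block block_matrix_mult block_matrix_add block_matrix_diff block_matrix_scaleR
  block_matrix_sum transpose_block_matrix

abbreviation JI :: "real ^ ('r \<times> 'q \<times> 'q) ^ ('r \<times> 'q \<times> 'q)"
  where "JI \<equiv> all_ones \<otimes>\<^sub>K mat 1"

abbreviation IJ :: "real ^ ('r \<times> 'q \<times> 'q) ^ ('r \<times> 'q \<times> 'q)"
  where "IJ \<equiv> mat 1 \<otimes>\<^sub>K all_ones"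

lemma transpose_N_matrix: "transpose (N_matrix \<phi> \<beta>) = N_matrix \<phi> (- \<beta>)"
  by (simp add: to_block_matrix transpose_line_matrix algebra_simps)

text \<open>In a fixed off-diagonal block, \<open>\<beta> * v\<close> runs through all nonzero field
  elements, so every parallel class appears once.\<close>

lemma sum_N_matrix:
  "(\<Sum>\<beta> | \<beta> \<noteq> 0. N_matrix \<phi> \<beta>) =
    all_ones - IJ + real CARD('q) *\<^sub>R (JI - mat 1)"
proof -
  have "(\<Sum>\<beta> | \<beta> \<noteq> 0. line_matrix (\<phi> (\<beta> * v))) =
      (if v = 0 then 0 else all_ones + real CARD('q) *\<^sub>R mat 1)" for v
  proof -
    \<comment> \<open>The added term \<open>\<beta> = 0\<close> is zero because
      \<open>\<phi> 0 = Sym_x\<close>.\<close>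
    have "(\<Sum>\<beta> | \<beta> \<noteq> 0. line_matrix (\<phi> (\<beta> * v))) = (\<Sum>\<beta>\<in>UNIV. line_matrix (\<phi> (\<beta> * v)))"
      by (intro sum.mono_neutral_left) (auto simp: \<phi>_0)
    then show ?thesis
      by (auto simp: \<phi>_0 bij_mult_right sum_line_matrix_bij)
  qed
  then show ?thesis
    by (simp add: to_block_matrix) (intro arg_cong[where f = block_matrix] ext, simp)
qed

text \<open>Multiplying by \<open>JI\<close> sums the blocks of a column or row; multiplying by
  \<open>IJ\<close> turns each block into \<open>q\<close> times all-ones, except the zero diagonal
  blocks.\<close>

lemma kronecker_mult_N_matrix:
  assumes "\<beta> \<noteq> 0"
  shows "JI ** N_matrix \<phi> \<beta> = all_ones + real CARD('q) *\<^sub>R JI"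
    and "N_matrix \<phi> \<beta> ** JI = all_ones + real CARD('q) *\<^sub>R JI"
    and "IJ ** N_matrix \<phi> \<beta> = real CARD('q) *\<^sub>R (all_ones - IJ)"
    and "N_matrix \<phi> \<beta> ** IJ = real CARD('q) *\<^sub>R (all_ones - IJ)"
proof -
  show "JI ** N_matrix \<phi> \<beta> = all_ones + real CARD('q) *\<^sub>R JI"
    and "N_matrix \<phi> \<beta> ** JI = all_ones + real CARD('q) *\<^sub>R JI"
    by (simp_all add: to_block_matrix sum_line_matrix_bij bij_scaled_difference assms)
  let ?J = "all_ones :: real ^ ('q \<times> 'q) ^ ('q \<times> 'q)"
  have "line_matrix (\<phi> (\<beta> * (b' - b))) ** ?J = real CARD('q) *\<^sub>R (?J - (if b = b' then ?J else 0))"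
    and "?J ** line_matrix (\<phi> (\<beta> * (b' - b))) = real CARD('q) *\<^sub>R (?J - (if b = b' then ?J else 0))"
    for b b'
    using assms by (simp_all add: \<phi>_0 \<phi>_eq_Sym_x_iff line_matrix_mult_all_ones)
  then show "IJ ** N_matrix \<phi> \<beta> = real CARD('q) *\<^sub>R (all_ones - IJ)"
    and "N_matrix \<phi> \<beta> ** IJ = real CARD('q) *\<^sub>R (all_ones - IJ)"
    by (simp_all only: to_block_matrix sum_block_delta)
qed

lemma N_matrix_mult:
  assumes "\<beta> \<noteq> 0" "\<gamma> \<noteq> 0" and CARD: "CARD('r) = CARD('q) + 2"
  shows "N_matrix \<phi> \<beta> ** N_matrix \<phi> \<gamma> =
    real CARD('q) *\<^sub>R all_ones + IJ +
    (if \<beta> + \<gamma> = 0 then real CARD('q) ^ 2 *\<^sub>R mat 1 - IJ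
     else real CARD('q) *\<^sub>R N_matrix \<phi> (\<beta> * \<gamma> / (\<beta> + \<gamma>)) - (all_ones - IJ))"
proof -
  let ?J = "all_ones :: real ^ ('q \<times> 'q) ^ ('q \<times> 'q)"
  \<comment> \<open>the deviation from \<open>J\<close> of the product of two equal parallel classes\<close>
  define excess where
    "excess v = real CARD('q) *\<^sub>R line_matrix (\<phi> v) - of_bool (v \<noteq> 0) *\<^sub>R ?J" for v
  have excess_0: "excess 0 = 0"
    by (simp add: excess_def \<phi>_0)
  \<comment> \<open>As \<open>excess 0 = 0\<close>, the correction for \<open>u = v\<close> needs no
    side condition excluding zero.\<close>
  have mult: "line_matrix (\<phi> u) ** line_matrix (\<phi> v) =
      of_bool (u \<noteq> 0 \<and> v \<noteq> 0) *\<^sub>R ?J + (if u = v then excess u else 0)" for u v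
  proof (cases "u = 0 \<or> v = 0")
    case True
    then show ?thesis by (auto simp: excess_0 \<phi>_0)
  next
    case False
    then show ?thesis
      by (simp add: line_matrix_mult \<phi>_eq_Sym_x_iff bij_is_inj[OF bij, THEN inj_eq] excess_def)
  qed
  \<comment> \<open>Only \<open>b' = b\<close> and \<open>b' = b''\<close> are excluded: of
    \<open>q + 2\<close> indices, \<open>q\<close> remain off the diagonal and \<open>q + 1\<close>
    on it.\<close>
  have avoid: "(\<Sum>b'\<in>UNIV. of_bool (\<beta> * (b' - b) \<noteq> 0 \<and> \<gamma> * (b'' - b') \<noteq> 0) *\<^sub>R ?J) =
      (real CARD('q) + of_bool (b = b'')) *\<^sub>R ?J" for b b''
  proof -
    have "{b'. \<beta> * (b' - b) \<noteq> 0 \<and> \<gamma> * (b'' - b') \<noteq> 0} = UNIV - {b, b''}"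
      using assms by auto
    moreover have "card (UNIV - {b, b''}) = CARD('q) + of_bool (b = b'')"
      using CARD by (simp add: card_Diff_subset card_insert_if)
    ultimately show ?thesis
      by (simp flip: scaleR_sum_left)
  qed
  have coincide: "(\<Sum>b'\<in>UNIV. if \<beta> * (b' - b) = \<gamma> * (b'' - b') then excess (\<beta> * (b' - b)) else 0) =
      (if \<beta> + \<gamma> = 0 then if b = b'' then real CARD('q) ^ 2 *\<^sub>R mat 1 - ?J else 0
       else excess (\<beta> * \<gamma> / (\<beta> + \<gamma>) * (b'' - b)))" for b b''
  proof (cases "\<beta> + \<gamma> = 0")
    case True
    then have \<gamma>: "\<gamma> = - \<beta>"
      by (simp add: add_eq_0_iff)
    have "\<beta> * (b' - b) = \<gamma> * (b'' - b') \<longleftrightarrow> b = b''" for b'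
    proof -
      have "\<beta> * (b' - b) - \<gamma> * (b'' - b') = \<beta> * (b'' - b)"
        by (simp add: \<gamma> algebra_simps)
      then show ?thesis
        using assms(1) by (metis eq_iff_diff_eq_0 mult_eq_0_iff)
    qed
    \<comment> \<open>The parallel classes contribute \<open>q (J + q I)\<close>, from which
      \<open>q + 1\<close> copies of \<open>J\<close> are subtracted.\<close>
    moreover have "(\<Sum>b'\<in>UNIV. excess (\<beta> * (b' - b))) = real CARD('q) ^ 2 *\<^sub>R mat 1 - ?J"
    proof -
      have "{b'. \<beta> * (b' - b) \<noteq> 0} = UNIV - {b}"
        using assms by auto
      then have "(\<Sum>b'\<in>UNIV. of_bool (\<beta> * (b' - b) \<noteq> 0)) = real CARD('q) + 1"
        using CARD by (simp add: card_Diff_subset)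
      then show ?thesis
        unfolding excess_def sum_subtractf scaleR_sum_right[symmetric] scaleR_sum_left[symmetric]
          sum_line_matrix_bij[OF bij_scaled_difference(1)[OF assms(1)]]
        by (simp add: scaleR_add_right scaleR_add_left power2_eq_square)
    qed
    ultimately show ?thesis
      using True by (cases "b = b''") simp_all
  next
    case False
    \<comment> \<open>The unique coincidence index is the mean of \<open>b\<close> and
      \<open>b''\<close> with weights \<open>\<beta>\<close> and \<open>\<gamma>\<close>.\<close>
    let ?c = "(\<beta> * b + \<gamma> * b'') / (\<beta> + \<gamma>)"
    have "\<beta> * (b' - b) = \<gamma> * (b'' - b') \<longleftrightarrow> b' = ?c" for b'
    proof -
      have "\<beta> * (b' - b) = \<gamma> * (b'' - b') \<longleftrightarrow> b' * (\<beta> + \<gamma>) = \<beta> * b + \<gamma> * b''"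
        by algebra
      with False show ?thesis
        by (simp add: eq_divide_eq)
    qed
    moreover have "\<beta> * (?c - b) = \<beta> * \<gamma> / (\<beta> + \<gamma>) * (b'' - b)"
      using False by (simp add: divide_simps) algebra
    ultimately show ?thesis
      using False by simp
  qed
  have block: "(\<Sum>b'\<in>UNIV. line_matrix (\<phi> (\<beta> * (b' - b))) ** line_matrix (\<phi> (\<gamma> * (b'' - b')))) =
      (real CARD('q) + of_bool (b = b'')) *\<^sub>R ?J +
      (if \<beta> + \<gamma> = 0 then if b = b'' then real CARD('q) ^ 2 *\<^sub>R mat 1 - ?J else 0
       else excess (\<beta> * \<gamma> / (\<beta> + \<gamma>) * (b'' - b)))" for b b''
    by (simp only: mult sum.distrib avoid coincide)
  show ?thesis
  proof (cases "\<beta> + \<gamma> = 0")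
    case True
    show ?thesis
      unfolding if_P[OF True] to_block_matrix block
      by (intro arg_cong[where f = block_matrix] ext) (simp add: scaleR_add_left)
  next
    case False
    \<comment> \<open>Since \<open>\<beta> * \<gamma> / (\<beta> + \<gamma>)\<close> is nonzero, the
      argument vanishes exactly on diagonal blocks.\<close>
    then have "excess (\<beta> * \<gamma> / (\<beta> + \<gamma>) * (b'' - b)) =
        real CARD('q) *\<^sub>R line_matrix (\<phi> (\<beta> * \<gamma> / (\<beta> + \<gamma>) * (b'' - b))) -
        (?J - (if b = b'' then ?J else 0))" for b b''
      using assms(1,2) by (simp add: excess_def)
    then show ?thesis
      unfolding if_not_P[OF False] to_block_matrix block
      by (intro arg_cong[where f = block_matrix] ext) (simp add: scaleR_add_left)
  qed
qed

lemma kronecker_mult_kronecker: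
  "JI ** JI = real CARD('r) *\<^sub>R JI"
  "JI ** IJ = all_ones"
  "IJ ** JI = all_ones"
  "IJ ** IJ = real (CARD('q)\<^sup>2) *\<^sub>R IJ"
  by (simp_all add: to_block_matrix sum_block_delta sum_constant_scaleR del: sum_constant)
    (intro arg_cong[where f = block_matrix] ext, simp add: all_ones_mult_all_ones power2_eq_square)

section \<open>The association scheme\<close>

lemma A1_eq: "A1_matrix = JI - mat 1"
  by (auto simp: A1_matrix_def kronecker_def vec_eq_iff all_ones_def mat_def)

lemma scheme_matrix_Ix2_eq: "scheme_matrix \<phi> Ix2 = IJ - mat 1"
  by (auto simp: kronecker_def vec_eq_iff all_ones_def mat_def)

lemma sum_scheme_indices:
  fixes f :: "'r scheme_index \<Rightarrow> 'c::comm_monoid_add"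
  shows "(\<Sum>i\<in>scheme_indices. f i) = f Ix0 + f Ix1 + f Ix2 + (\<Sum>\<beta> | \<beta> \<noteq> 0. f (Ix3 \<beta>))"
proof -
  have "(\<Sum>i\<in>scheme_indices. f i) = (\<Sum>i\<in>{Ix0, Ix1, Ix2}. f i) + (\<Sum>i\<in>Ix3 ` {\<beta>. \<beta> \<noteq> 0}. f i)"
    unfolding scheme_indices_def by (intro sum.union_disjoint) auto
  then show ?thesis
    by (simp add: sum.reindex inj_on_def add.assoc)
qed

text \<open>The \<open>q + 1\<close> subtracted copies of \<open>A1_matrix\<close> cancel the
  \<open>q\<close> copies inside \<open>sum_N_matrix\<close> and the term of
  \<open>Ix1\<close>.\<close>

lemma sum_scheme_matrix:
  assumes CARD: "CARD('r) = CARD('q) + 2"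
  shows "(\<Sum>i\<in>scheme_indices. scheme_matrix \<phi> i) = all_ones"
proof -
  have "card {\<beta>::'r. \<beta> \<noteq> 0} = CARD('q) + 1"
    using CARD by (simp add: card_Diff_subset set_diff_eq[of UNIV "{0}", simplified, symmetric])
  then have "(\<Sum>\<beta> | \<beta> \<noteq> 0. scheme_matrix \<phi> (Ix3 \<beta>)) =
      (\<Sum>\<beta> | \<beta> \<noteq> 0. N_matrix \<phi> \<beta>) - real (CARD('q) + 1) *\<^sub>R A1_matrix"
    by (simp only: scheme_matrix.simps sum_subtractf sum_constant_scaleR)
  then show ?thesis
    by (simp add: sum_scheme_indices scheme_matrix_Ix2_eq A1_eq sum_N_matrix scaleR_add_left
        del: scheme_matrix.simps(3,4))
qed

section \<open>Number of indices, entries and transposes\<close>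

lemma card_scheme_indices: "card (scheme_indices :: 'r scheme_index set) = CARD('r) + 2"
proof -
  have "card (scheme_indices :: 'r scheme_index set) = Suc (Suc (Suc (card {\<beta>::'r. \<beta> \<noteq> 0})))"
    unfolding card_eq_sum[of scheme_indices] sum_scheme_indices by simp
  moreover have "Suc (card {\<beta>::'r. \<beta> \<noteq> 0}) = CARD('r)"
    using card_Suc_Diff1[of UNIV "0 :: 'r"] by (simp add: set_diff_eq)
  ultimately show ?thesis by simp
qed

text \<open>Subtracting \<open>A1_matrix\<close> creates no negative entry: in an off-diagonal block
  of \<open>N_matrix\<close> each point is collinear with itself, so the diagonal entries are
  1.\<close>

lemma scheme_matrix_01:
  assumes "i \<in> scheme_indices"
  shows "scheme_matrix \<phi> i $ s $ t \<in> {0, 1}"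
proof (cases i)
  case (Ix3 \<beta>)
  with assms have "\<beta> \<noteq> 0"
    by (auto simp: scheme_indices_def)
  then show ?thesis
    using Ix3
    by (auto simp: A1_eq to_block_matrix \<phi>_0 \<phi>_eq_Sym_x_iff)
      (auto simp: block_matrix_def line_matrix_def mat_def \<phi>_eq_Sym_x_iff)
qed (auto simp: A1_matrix_def kronecker_def all_ones_def mat_def)

lemma scheme_matrix_nonzero:
  assumes "i \<in> scheme_indices"
  shows "scheme_matrix \<phi> i \<noteq> 0"
proof -
  have nonzero: "M \<noteq> 0" if "M $ s $ t = 1" for M :: "real ^ ('r \<times> 'q \<times> 'q) ^ ('r \<times> 'q \<times> 'q)" and s t
    using that by auto
  show ?thesis
  proof (cases i)
    case Ix0
    then show ?thesis
      by (intro nonzero[where s = 0 and t = 0]) (simp add: mat_def)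
  next
    case Ix1
    then show ?thesis
      by (intro nonzero[where s = "(0, 0, 0)" and t = "(1, 0, 0)"])
        (simp add: A1_matrix_def kronecker_def all_ones_def mat_def)
  next
    case Ix2
    then show ?thesis
      by (intro nonzero[where s = "(0, 0, 0)" and t = "(0, 0, 1)"])
        (simp add: kronecker_def all_ones_def mat_def)
  next
    case (Ix3 \<beta>)
    with assms have "\<beta> \<noteq> 0"
      by (auto simp: scheme_indices_def)
    \<comment> \<open>A second point on the line through the origin in class
      \<open>\<phi> \<beta>\<close>; its entry in block \<open>(0, 1)\<close> survives the
      subtraction of the identity.\<close>
    then obtain p where "p \<noteq> (0, 0)" "line_matrix (\<phi> \<beta>) $ (0, 0) $ p = 1"
    proof (cases "\<phi> \<beta>")
      case (Elem c)
      then show ?thesis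
        by (intro that[of "(1, c)"]) (auto simp: line_matrix_def)
    next
      case Sym_y
      then show ?thesis
        by (intro that[of "(0, 1)"]) (auto simp: line_matrix_def)
    qed (simp add: \<phi>_eq_Sym_x_iff)
    then show ?thesis
      unfolding Ix3
      by (intro nonzero[where s = "(0, 0, 0)" and t = "(1, p)"])
        (auto simp: A1_eq to_block_matrix block_matrix_def mat_def)
  qed
qed

lemma transpose_scheme_matrix:
  "transpose A1_matrix = A1_matrix"
  "transpose (scheme_matrix \<phi> Ix2) = scheme_matrix \<phi> Ix2"
  "transpose (scheme_matrix \<phi> (Ix3 \<beta>)) = scheme_matrix \<phi> (Ix3 (- \<beta>))"
proof -
  have diff: "transpose (M - N) = transpose M - transpose N" for M N :: "real ^ ('r \<times> 'q \<times> 'q) ^ ('r \<times> 'q \<times> 'q)"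
    by (simp add: transpose_def vec_eq_iff)
  show A1: "transpose A1_matrix = A1_matrix"
    by (auto simp: A1_matrix_def kronecker_def transpose_def vec_eq_iff all_ones_def mat_def)
  show "transpose (scheme_matrix \<phi> Ix2) = scheme_matrix \<phi> Ix2"
    by (auto simp: kronecker_def transpose_def vec_eq_iff all_ones_def mat_def)
  show "transpose (scheme_matrix \<phi> (Ix3 \<beta>)) = scheme_matrix \<phi> (Ix3 (- \<beta>))"
    by (simp add: diff A1 transpose_N_matrix)
qed

section \<open>The algebra spanned by the scheme\<close>

definition generators :: "(real ^ ('r \<times> 'q \<times> 'q) ^ ('r \<times> 'q \<times> 'q)) set"
  where "generators = {mat 1, JI, IJ} \<union> N_matrix \<phi> ` {\<beta>. \<beta> \<noteq> 0}"

lemma generators_cases: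
  "M \<in> generators \<Longrightarrow> M = mat 1 \<or> M = JI \<or> M = IJ \<or> (\<exists>\<beta>. \<beta> \<noteq> 0 \<and> M = N_matrix \<phi> \<beta>)"
  by (auto simp: generators_def)

text \<open>The change of spanning family is triangular: \<open>JI\<close> and \<open>IJ\<close>
  arise by adding the identity, \<open>N_matrix\<close> by adding \<open>A1_matrix\<close>.\<close>

lemma span_generators: "span generators = span (scheme_matrix \<phi> ` scheme_indices)"
proof -
  let ?A = "scheme_matrix \<phi> ` scheme_indices" and ?N = "N_matrix \<phi>"
  have gen: "mat 1 \<in> span generators" "JI \<in> span generators" "IJ \<in> span generators"
    and gen_N: "\<And>\<beta>. \<beta> \<noteq> 0 \<Longrightarrow> ?N \<beta> \<in> span generators"
    by (auto simp: generators_def intro: span_base)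
  have A: "scheme_matrix \<phi> i \<in> span ?A" if "i \<in> scheme_indices" for i
    using that by (intro span_base imageI)
  have Ix: "Ix0 \<in> scheme_indices" "Ix1 \<in> scheme_indices" "Ix2 \<in> scheme_indices"
    "\<And>\<beta>. \<beta> \<noteq> 0 \<Longrightarrow> Ix3 \<beta> \<in> scheme_indices"
    by (auto simp: scheme_indices_def)
  have A0: "mat 1 \<in> span ?A" and A1: "A1_matrix \<in> span ?A"
    using A[OF Ix(1)] A[OF Ix(2)] by simp_all
  have "scheme_matrix \<phi> i \<in> span generators" if "i \<in> scheme_indices" for i
    using that unfolding scheme_indices_def
    by (auto simp: scheme_matrix_Ix2_eq A1_eq simp del: scheme_matrix.simps(3)
        intro!: span_diff gen gen_N)
  moreover have "JI \<in> span ?A"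
    using span_add[OF A1 A0] by (simp add: A1_eq)
  moreover have "IJ \<in> span ?A"
    using span_add[OF A[OF Ix(3)] A0] by (simp add: scheme_matrix_Ix2_eq del: scheme_matrix.simps(3))
  moreover have "?N \<beta> \<in> span ?A" if "\<beta> \<noteq> 0" for \<beta>
    using span_add[OF A[OF Ix(4)[OF that]] A1] by simp
  ultimately show ?thesis
    using A0 unfolding span_eq generators_def by auto
qed

text \<open>Products of generators produce \<open>all_ones\<close>, which is not listed as a
  generator but is the sum of the scheme matrices.\<close>

lemma all_ones_in_span_generators:
  assumes "CARD('r) = CARD('q) + 2"
  shows "all_ones \<in> span generators"
  unfolding span_generators sum_scheme_matrix[OF assms, symmetric]
  by (intro span_sum span_base) auto

lemma generators_mult_closed:
  assumes CARD: "CARD('r) = CARD('q) + 2" and "M \<in> generators" "N \<in> generators"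
  shows "M ** N \<in> span generators"
proof -
  have gen: "mat 1 \<in> span generators" "JI \<in> span generators" "IJ \<in> span generators"
    and gen_N: "\<And>\<beta>. \<beta> \<noteq> 0 \<Longrightarrow> N_matrix \<phi> \<beta> \<in> span generators"
    by (auto simp: generators_def intro: span_base)
  note closed = gen gen_N all_ones_in_span_generators[OF CARD] span_add span_diff span_scale
  \<comment> \<open>For \<open>\<beta> + \<gamma> \<noteq> 0\<close> the new parameter
    \<open>\<beta> * \<gamma> / (\<beta> + \<gamma>)\<close> is nonzero, so its matrix is again a
    generator.\<close>
  have N: "N_matrix \<phi> \<beta> ** N_matrix \<phi> \<gamma> \<in> span generators" if "\<beta> \<noteq> 0" "\<gamma> \<noteq> 0" for \<beta> \<gamma>
    unfolding N_matrix_mult[OF that CARD]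
    by (cases "\<beta> + \<gamma> = 0"; simp only: if_True if_False simp_thms; intro closed; simp add: that)
  show ?thesis
    using generators_cases[OF assms(2)] generators_cases[OF assms(3)]
    by (auto simp: kronecker_mult_kronecker kronecker_mult_N_matrix intro!: closed N)
qed

text \<open>The formula for two \<open>N_matrix\<close> factors is symmetric, and the mixed products
  were computed to the same value in both orders.\<close>

lemma generators_mult_commute:
  assumes CARD: "CARD('r) = CARD('q) + 2" and "M \<in> generators" "N \<in> generators"
  shows "M ** N = N ** M"
proof -
  have "N_matrix \<phi> \<beta> ** N_matrix \<phi> \<gamma> = N_matrix \<phi> \<gamma> ** N_matrix \<phi> \<beta>"
    if "\<beta> \<noteq> 0" "\<gamma> \<noteq> 0" for \<beta> \<gamma>
    using that CARD by (simp add: N_matrix_mult add.commute mult.commute)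
  then show ?thesis
    using generators_cases[OF assms(2)] generators_cases[OF assms(3)]
    by (auto simp: kronecker_mult_kronecker kronecker_mult_N_matrix)
qed

end

theorem theorem3p2:
  fixes q :: nat
    and \<phi> :: "'r::{field,finite} \<Rightarrow> 'q::{field,finite} extended_field"
  assumes "primepow q" and "primepow (q + 2)"
    and "CARD('q) = q" and "CARD('r) = q + 2"
    and "bij \<phi>" and "\<phi> 0 = Sym_x"
  shows "commutative_association_scheme (q + 3) scheme_indices Ix0 (scheme_matrix \<phi>)"
proof -
  let ?A = "scheme_matrix \<phi>" and ?I = "scheme_indices :: 'r scheme_index set"
  have CARD: "CARD('r) = CARD('q) + 2"
    using assms by simp
  note bij = \<open>bij \<phi>\<close> and \<phi>_0 = \<open>\<phi> 0 = Sym_x\<close>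
  have fin: "finite ?I"
    by (simp add: scheme_indices_def)
  have in_span: "?A i \<in> span (generators \<phi>)" if "i \<in> ?I" for i
    unfolding span_generators[OF bij \<phi>_0] using that by (intro span_base imageI)
  have products: "\<exists>p. ?A i ** ?A j = (\<Sum>k\<in>?I. p k *\<^sub>R ?A k)" if "i \<in> ?I" "j \<in> ?I" for i j
  proof -
    have "?A i ** ?A j \<in> span (generators \<phi>)"
      by (rule span_matrix_mult_closed[OF _ in_span[OF that(1)] in_span[OF that(2)]])
        (rule generators_mult_closed[OF bij \<phi>_0 CARD])
    then show ?thesis
      unfolding span_generators[OF bij \<phi>_0] by (rule span_image_imp_sum[OF fin])
  qed
  have commute: "?A i ** ?A j = ?A j ** ?A i" if "i \<in> ?I" "j \<in> ?I" for i j
    by (rule span_matrix_mult_commute[OF _ in_span[OF that(1)] in_span[OF that(2)]])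
      (rule generators_mult_commute[OF bij \<phi>_0 CARD])
  have transp: "transpose (?A i) \<in> ?A ` (?I - {Ix0})" if "i \<in> ?I - {Ix0}" for i
  proof (cases i)
    case (Ix3 \<beta>)
    with that have "Ix3 (- \<beta>) \<in> ?I - {Ix0}"
      by (auto simp: scheme_indices_def)
    then show ?thesis
      unfolding Ix3 transpose_scheme_matrix[OF bij \<phi>_0] by (rule imageI)
  next
    case Ix1
    with that show ?thesis
      by (intro image_eqI[where x = Ix1]) (simp_all add: transpose_scheme_matrix[OF bij \<phi>_0])
  next
    case Ix2
    with that show ?thesis
      by (intro image_eqI[where x = Ix2])
        (simp_all add: transpose_scheme_matrix[OF bij \<phi>_0] del: scheme_matrix.simps(3))
  qed (use that in auto)
  \<comment> \<open>Three special indices and \<open>q + 1\<close> nonzero field elements.\<close>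
  have "card ?I = (q + 3) + 1"
    using card_scheme_indices[OF bij \<phi>_0] assms(4) by simp
  moreover have "Ix0 \<in> ?I"
    by (simp add: scheme_indices_def)
  ultimately show ?thesis
    unfolding commutative_association_scheme_def
    using fin sum_scheme_matrix[OF bij \<phi>_0 CARD]
    by (intro conjI ballI allI products commute transp scheme_matrix_01[OF bij \<phi>_0]
        scheme_matrix_nonzero[OF bij \<phi>_0]) simp_all
qed

end
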